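(* Let $d\ge 1$ and $n\ge 1$ be integers, and let $Q(d,n)$ denote the maximum integer $q$ such that in every antipodal $n$-fold cover of $S^d$ with open sets there exists a point of $S^d$ that is covered by at least $q$ sets of the cover. Then \[\left\lceil \tfrac{d}{2}\right\rceil + n \le Q(d,n) \le d+n.\]
   Context: $S^d$ denotes the $d$-dimensional unit sphere in $\mathbb{R}^{d+1}$ centered at the origin. A cover of $S^d$ is a (finite) family of subsets of $S^d$; it is an $n$-fold cover if every point of $S^d$ belongs to at least $n$ of the sets. A cover is antipodal if none of its sets contains a pair of antipodal points $x,-x$. A point is covered $k$ times if it belongs to $k$ sets of the cover. *)

theory Defs
  imports "HOL-Analysis.Analysis"
begin

text \<open>A (finite) cover of the unit sphere of 'a is given as an indexed family
  U 0, ..., U (m-1) of subsets of the sphere (repetitions allowed).\<close>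

definition covered_count :: "(nat \<Rightarrow> 'a set) \<Rightarrow> nat \<Rightarrow> 'a \<Rightarrow> nat" where
  "covered_count U m x = card {i. i < m \<and> x \<in> U i}"

definition antipodal_open_nfold_cover ::
    "nat \<Rightarrow> (nat \<Rightarrow> 'a::euclidean_space set) \<Rightarrow> nat \<Rightarrow> bool" where
  "antipodal_open_nfold_cover n U m \<longleftrightarrow>
     (\<forall>i<m. U i \<subseteq> sphere 0 1
            \<and> openin (top_of_set (sphere 0 1)) (U i)
            \<and> (\<forall>x\<in>U i. - x \<notin> U i))
     \<and> (\<forall>x\<in>sphere 0 1. n \<le> covered_count U m x)"

text \<open>Q(d,n), where the sphere S^d is the unit sphere of 'a with DIM('a) = d+1.\<close>

definition Q :: "'a::euclidean_space itself \<Rightarrow> nat \<Rightarrow> nat" where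
  "Q _ n = (GREATEST q. \<forall>(U :: nat \<Rightarrow> 'a set) m.
              antipodal_open_nfold_cover n U m \<longrightarrow>
              (\<exists>x\<in>sphere (0::'a) 1. q \<le> covered_count U m x))"

end

theory Submission
  imports Defs "HOL-Homology.Homology" "HOL-Library.Multiset" "HOL-Computational_Algebra.Polynomial"
begin

text \<open>
  Lower bound. For a point \<open>x\<close> let \<open>A\<close> and \<open>B\<close> be the index sets of the members containing \<open>x\<close>
  and \<open>- x\<close>; they are disjoint and of size at least \<open>n\<close>. If all points were covered fewer than
  \<open>n + \<lceil>d/2\<rceil>\<close> times, then \<open>card A + card B - 2 * n\<close> would take values below \<open>d\<close> only. Attaching to
  each pair \<open>(A, B)\<close> an antisymmetric sign and a continuous weight, and summing over all pairs with
  \<open>card A + card B = 2 * n + r\<close>, gives \<open>d\<close> odd functions of \<open>x\<close>. They have no common zero, because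
  the pair belonging to \<open>x\<close> itself is the only one of its level whose weight does not vanish
  at \<open>x\<close>. This contradicts the Borsuk--Ulam theorem.

  Borsuk--Ulam. Since the reduced homology of the sphere vanishes below dimension \<open>d\<close>, there are
  singular chains \<open>h\<^sub>0, \<dots>, h\<^sub>d\<close>, with \<open>h\<^sub>0\<close> a point, such that \<open>\<partial>h\<^sub>k\<^sub>+\<^sub>1 = h\<^sub>k \<plusminus> a h\<^sub>k\<close> for the
  antipodal map \<open>a\<close>. Label a point by the index and sign of its dominant coordinate function. On
  finely subdivided chains, Ky Fan's cochains \<open>\<phi>\<^sub>k\<close> (which detect the \<open>k\<close>-simplices with alternating labels)
  satisfy \<open>\<phi>\<^sub>k + \<phi>\<^sub>k a = \<delta>\<phi>\<^sub>k\<^sub>-\<^sub>1\<close> modulo 2, so \<open>\<phi>\<^sub>d(h\<^sub>d + a h\<^sub>d)\<close> is odd, like \<open>\<phi>\<^sub>0(h\<^sub>0 + a h\<^sub>0)\<close>. But an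
  alternating \<open>d\<close>-simplex needs \<open>d + 1\<close> distinct indices.

  Upper bound. By Gale's lemma there are \<open>2 * n + d\<close> vectors, taken with alternating signs on the
  moment curve, such that every open hemisphere contains at least \<open>n\<close> of them. The
  hemispheres centred at them cover \<open>x\<close> and \<open>- x\<close> at least \<open>n\<close> times each and no hemisphere
  contains both, so \<open>x\<close> is covered at most \<open>n + d\<close> times.
\<close>

section \<open>Ky Fan's alternating cochains\<close>

fun alternates :: "bool \<Rightarrow> bool list \<Rightarrow> bool" where
  "alternates b [] = True"
| "alternates b (x # xs) = (x = b \<and> alternates (\<not> b) xs)"

lemma alternates_map_Not: "alternates b (map Not xs) = alternates (\<not> b) xs"
  by (induction xs arbitrary: b) auto

definition remove_nth :: "nat \<Rightarrow> 'a list \<Rightarrow> 'a list" where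
  "remove_nth i xs = take i xs @ drop (Suc i) xs"

text \<open>The combinatorial core of Fan's identity. Deleting the head leaves \<open>xs\<close>;
  the other deletions keep the head and act on \<open>xs\<close> with the sign flipped. If
  \<open>x = b\<close>, the induction hypothesis applies; otherwise only two terms survive, and they
  are equal.\<close>

lemma even_alternates_coboundary:
  "even ((\<Sum>i<length xs. of_bool (alternates b (remove_nth i xs)))
         + of_bool (alternates b xs) + of_bool (alternates (\<not> b) xs) :: int)"
proof (induction xs arbitrary: b)
  case Nil
  then show ?case by simp
next
  case (Cons x xs)
  have "(\<Sum>i<length (x # xs). of_bool (alternates b (remove_nth i (x # xs))) :: int)
      = of_bool (alternates b xs)
        + of_bool (x = b) * (\<Sum>i<length xs. of_bool (alternates (\<not> b) (remove_nth i xs)))"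
    by (simp add: sum.lessThan_Suc_shift remove_nth_def sum_distrib_left del: sum.lessThan_Suc)
  then show ?case using Cons.IH[of "\<not> b"] by auto
qed

lemma mset_remove_nth: "i < length xs \<Longrightarrow> mset (remove_nth i xs) = mset xs - {#xs ! i#}"
  by (subst (2) id_take_nth_drop[of i xs]) (auto simp: remove_nth_def)

lemma sorted_remove_nth:
  assumes "sorted xs" shows "sorted (remove_nth i xs)"
proof (cases "i < length xs")
  case True
  have "sorted (take i xs @ xs ! i # drop (Suc i) xs)"
    using assms id_take_nth_drop[OF True] by simp
  then show ?thesis by (auto simp: remove_nth_def sorted_append)
next
  case False
  then show ?thesis using assms by (simp add: remove_nth_def)
qed

lemma map_remove_nth: "map f (remove_nth i xs) = remove_nth i (map f xs)"
  by (simp add: remove_nth_def take_map drop_map)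

text \<open>The labels \<open>\<plusminus>1, \<plusminus>2, \<dots>\<close> are encoded as natural numbers: the label of absolute value
  \<open>i + 1\<close> is \<open>2 * i\<close> or \<open>2 * i + 1\<close> according to its sign.\<close>

definition opposite :: "nat \<Rightarrow> nat" where
  "opposite c = (if even c then c + 1 else c - 1)"

text \<open>Equal halves mean equal absolute values, so this excludes complementary edges, as in the
  lemmas of Tucker and Fan.\<close>

definition compatible :: "nat multiset \<Rightarrow> bool" where
  "compatible M \<longleftrightarrow> (\<forall>x\<in>#M. \<forall>y\<in>#M. x div 2 = y div 2 \<longrightarrow> x = y)"

text \<open>Sorting the codes orders the labels by absolute value and parity gives the sign, so this
  marks Fan's alternating simplices, in the orientation whose smallest label has an odd
  code.\<close>

definition fan_sign :: "nat multiset \<Rightarrow> int" where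
  "fan_sign M = of_bool (alternates True (map odd (sorted_list_of_multiset M)))"

lemma fan_sign_mset: "sorted xs \<Longrightarrow> fan_sign (mset xs) = of_bool (alternates True (map odd xs))"
  by (simp add: fan_sign_def sorted_sort_id)

lemma odd_opposite: "odd (opposite c) \<longleftrightarrow> even c"
  by (auto simp: opposite_def)

lemma opposite_mono:
  assumes "x \<le> y" "x div 2 = y div 2 \<longrightarrow> x = y"
  shows "opposite x \<le> opposite y"
  using assms unfolding opposite_def by presburger

text \<open>On compatible labels \<open>opposite\<close> keeps the sorted order, since it could only
  disturb a pair \<open>2 * i\<close>, \<open>2 * i + 1\<close>; hence it merely negates all
  parities.\<close>

lemma fan_sign_opposite:
  assumes "compatible M"
  shows "fan_sign (image_mset opposite M) = of_bool (alternates False (map odd (sorted_list_of_multiset M)))"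
proof -
  define xs where "xs = sorted_list_of_multiset M"
  have M: "M = mset xs" and s: "sorted xs" by (simp_all add: xs_def)
  have "sorted (map opposite xs)"
    using s assms unfolding M compatible_def sorted_map
    by (auto intro!: opposite_mono elim!: sorted_wrt_mono_rel[rotated])
  then have "fan_sign (mset (map opposite xs)) = of_bool (alternates True (map odd (map opposite xs)))"
    by (rule fan_sign_mset)
  moreover have "map odd (map opposite xs) = map Not (map odd xs)"
    by (simp add: odd_opposite)
  ultimately show ?thesis
    by (simp only: M mset_map alternates_map_Not sorted_list_of_multiset_mset sorted_sort_id[OF s]) simp
qed

lemma even_fan_sign_coboundary:
  assumes "compatible M"
  shows "even ((\<Sum>x\<in>#M. fan_sign (M - {#x#})) + fan_sign M + fan_sign (image_mset opposite M))"
proof -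
  define xs where "xs = sorted_list_of_multiset M"
  have M: "M = mset xs" and s: "sorted xs" by (simp_all add: xs_def)
  have "(\<Sum>x\<in>#M. fan_sign (M - {#x#})) = (\<Sum>i<length xs. fan_sign (mset xs - {#xs ! i#}))"
    by (simp only: M mset_map[symmetric] sum_mset_sum_list sum_list_sum_nth length_map)
       (simp add: atLeast0LessThan)
  also have "\<dots> = (\<Sum>i<length xs. of_bool (alternates True (remove_nth i (map odd xs))))"
    by (intro sum.cong)
       (auto simp: mset_remove_nth[symmetric] fan_sign_mset sorted_remove_nth s map_remove_nth)
  finally show ?thesis
    using even_alternates_coboundary[where xs = "map odd xs" and b = True] fan_sign_opposite[OF assms]
    by (simp add: fan_sign_def xs_def[symmetric])
qed

text \<open>Alternation makes neighbours differ; by compatibility they then also differ in absolute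
  value.\<close>

lemma alternates_strictly_increasing:
  assumes "alternates b (map odd xs)" "sorted xs" "compatible (mset xs)"
  shows "sorted_wrt (<) (map (\<lambda>x. x div 2) xs)"
  using assms
proof (induction xs arbitrary: b)
  case Nil
  then show ?case by simp
next
  case (Cons x xs)
  have IH: "sorted_wrt (<) (map (\<lambda>x. x div 2) xs)"
    using Cons.prems by (intro Cons.IH) (auto simp: compatible_def)
  show ?case
  proof (cases xs)
    case Nil
    then show ?thesis by simp
  next
    case (Cons y ys)
    have "x \<noteq> y" "x \<le> y" using Cons.prems Cons by auto
    moreover from \<open>x \<noteq> y\<close> have "x div 2 \<noteq> y div 2" using Cons.prems(3) Cons by (auto simp: compatible_def)
    ultimately have "x div 2 < y div 2" using div_le_mono[of x y 2] by linarith
    then show ?thesis using IH Cons by auto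
  qed
qed

text \<open>Pigeonhole: an alternating sequence has distinct absolute values, and only
  \<open>d\<close> are available.\<close>

lemma fan_sign_eq_0:
  assumes "compatible M" "\<And>x. x \<in># M \<Longrightarrow> x < 2 * d" "size M > d"
  shows "fan_sign M = 0"
proof (rule ccontr)
  define xs where "xs = sorted_list_of_multiset M"
  have M: "M = mset xs" and s: "sorted xs" by (simp_all add: xs_def)
  assume "fan_sign M \<noteq> 0"
  then have "alternates True (map odd xs)" by (auto simp: fan_sign_def xs_def)
  then have "distinct (map (\<lambda>x. x div 2) xs)"
    using alternates_strictly_increasing s assms(1) M strict_sorted_iff by blast
  then have "length xs = card (set (map (\<lambda>x. x div 2) xs))"
    by (metis distinct_card length_map)
  also have "\<dots> \<le> card {..<d}"
  proof (intro card_mono)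
    have "x div 2 < d" if "x \<in> set xs" for x
      using assms(2)[of x] that M by simp
    then show "set (map (\<lambda>x. x div 2) xs) \<subseteq> {..<d}" by auto
  qed simp
  finally show False using assms(3) M by simp
qed

section \<open>Integer cochains evaluated on singular chains\<close>

definition chain_eval :: "('a \<Rightarrow> int) \<Rightarrow> ('a \<Rightarrow>\<^sub>0 int) \<Rightarrow> int" where
  "chain_eval \<phi> c = (\<Sum>x\<in>Poly_Mapping.keys c. Poly_Mapping.lookup c x * \<phi> x)"

text \<open>The integers appear as the free abelian group on one generator, so linearity of
  evaluation follows from that of \<open>frag_extend\<close>.\<close>

lemma chain_eval_frag_extend:
  "chain_eval \<phi> c = Poly_Mapping.lookup (frag_extend (\<lambda>x. frag_cmul (\<phi> x) (frag_of ())) c) ()"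
  by (simp add: chain_eval_def frag_extend_def lookup_sum)

lemma chain_eval_of [simp]: "chain_eval \<phi> (frag_of x) = \<phi> x"
  by (simp add: chain_eval_frag_extend)

lemma chain_eval_0 [simp]: "chain_eval \<phi> 0 = 0"
  by (simp add: chain_eval_def)

lemma chain_eval_add: "chain_eval \<phi> (a + b) = chain_eval \<phi> a + chain_eval \<phi> b"
  by (simp add: chain_eval_frag_extend frag_extend_add lookup_add)

lemma chain_eval_diff: "chain_eval \<phi> (a - b) = chain_eval \<phi> a - chain_eval \<phi> b"
  by (simp add: chain_eval_frag_extend frag_extend_diff lookup_minus)

lemma chain_eval_cmul: "chain_eval \<phi> (frag_cmul k a) = k * chain_eval \<phi> a"
  by (simp add: chain_eval_frag_extend frag_extend_cmul)

lemma chain_eval_sum: "chain_eval \<phi> (sum f I) = (\<Sum>i\<in>I. chain_eval \<phi> (f i))"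
  by (induction I rule: infinite_finite_induct) (auto simp: chain_eval_add)

lemma chain_eval_fun_add: "chain_eval (\<lambda>x. \<phi> x + \<psi> x) c = chain_eval \<phi> c + chain_eval \<psi> c"
  by (simp add: chain_eval_def algebra_simps sum.distrib)

lemma even_chain_eval: "(\<And>x. x \<in> Poly_Mapping.keys c \<Longrightarrow> even (\<phi> x)) \<Longrightarrow> even (chain_eval \<phi> c)"
  by (auto simp: chain_eval_def intro!: dvd_sum)

lemma chain_eval_chain_map:
  "chain_eval \<phi> (chain_map p g c) = chain_eval (\<lambda>f. \<phi> (simplex_map p g f)) c"
  unfolding chain_map_def chain_eval_frag_extend frag_extend_compose by (simp add: o_def)

lemma chain_eval_boundary:
  assumes "p > 0"
  shows "chain_eval \<phi> (chain_boundary p c)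
       = chain_eval (\<lambda>f. \<Sum>k\<le>p. (-1) ^ k * \<phi> (singular_face p k f)) c"
  using subset_UNIV[of "Poly_Mapping.keys c"]
proof (induction c rule: frag_induction)
  case (one f)
  then show ?case
    using assms by (simp add: chain_boundary_of chain_eval_sum chain_eval_cmul)
qed (auto simp: chain_boundary_diff chain_eval_diff)

section \<open>Vertex labels of singular simplices and Fan's cochains\<close>

definition vertex_labels :: "('a \<Rightarrow> nat) \<Rightarrow> nat \<Rightarrow> ((nat \<Rightarrow> real) \<Rightarrow> 'a) \<Rightarrow> nat multiset" where
  "vertex_labels l p f = image_mset (\<lambda>j. l (f (\<lambda>i. if i = j then 1 else 0))) (mset_set {..p})"

lemma size_vertex_labels: "size (vertex_labels l p f) = Suc p"
  by (simp add: vertex_labels_def)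

lemma in_vertex_labelsE:
  assumes "c \<in># vertex_labels l p f"
  obtains v where "v \<in> standard_simplex p" "c = l (f v)"
proof -
  from assms obtain j where "j \<le> p" "c = l (f (\<lambda>i. if i = j then 1 else 0))"
    by (auto simp: vertex_labels_def)
  then show thesis using that[of "\<lambda>i. if i = j then 1 else 0"] by simp
qed

lemma vertex_labels_singular_face:
  assumes "k \<le> p" "p > 0"
  shows "vertex_labels l (p - Suc 0) (singular_face p k f)
       = vertex_labels l p f - {#l (f (\<lambda>i. if i = k then 1 else 0))#}"
proof -
  \<comment> \<open>The map of vertex indices induced by the inclusion of the \<open>k\<close>-th
    face.\<close>
  define s where "s = (\<lambda>j. if j < k then j else Suc j)"
  have inj: "inj_on s A" for A by (auto simp: inj_on_def s_def split: if_splits)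
  have im: "s ` {..p - Suc 0} = {..p} - {k}"
  proof
    show "{..p} - {k} \<subseteq> s ` {..p - Suc 0}"
    proof
      fix j assume "j \<in> {..p} - {k}"
      then show "j \<in> s ` {..p - Suc 0}"
        using assms by (intro image_eqI[of _ _ "if j < k then j else j - 1"]) (auto simp: s_def)
    qed
  qed (use assms in \<open>auto simp: s_def\<close>)
  have face: "singular_face p k f (\<lambda>i. if i = j then 1 else 0) = f (\<lambda>i. if i = s j then 1 else 0)"
    if "j \<le> p - Suc 0" for j
  proof -
    have "simplical_face k (\<lambda>i. if i = j then 1 else 0 :: real) = (\<lambda>i. if i = s j then 1 else 0)"
      by (auto simp: simplical_face_def s_def fun_eq_iff)
    then show ?thesis using that by (simp add: singular_face_def)
  qed
  have "vertex_labels l (p - Suc 0) (singular_face p k f)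
      = image_mset (\<lambda>j. l (f (\<lambda>i. if i = s j then 1 else 0))) (mset_set {..p - Suc 0})"
    unfolding vertex_labels_def by (intro image_mset_cong) (auto simp: face)
  also have "\<dots> = image_mset (\<lambda>j. l (f (\<lambda>i. if i = j then 1 else 0))) (image_mset s (mset_set {..p - Suc 0}))"
    by (simp add: multiset.map_comp o_def)
  also have "image_mset s (mset_set {..p - Suc 0}) = mset_set {..p} - {#k#}"
    using assms by (simp add: image_mset_mset_set inj im mset_set_Diff)
  finally show ?thesis
    using assms by (simp add: vertex_labels_def image_mset_Diff)
qed

lemma vertex_labels_simplex_map:
  assumes "singular_simplex p X f" "\<And>x. x \<in> topspace X \<Longrightarrow> l (a x) = opposite (l x)"
  shows "vertex_labels l p (simplex_map p a f) = image_mset opposite (vertex_labels l p f)"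
proof -
  have "f v \<in> topspace X" if "v \<in> standard_simplex p" for v
    using assms(1) that by (auto simp: singular_simplex_def continuous_map_def)
  then show ?thesis
    unfolding vertex_labels_def multiset.map_comp
    by (intro image_mset_cong) (auto simp: simplex_map_def assms(2))
qed

definition fan_cochain :: "('a \<Rightarrow> nat) \<Rightarrow> nat \<Rightarrow> ((nat \<Rightarrow> real) \<Rightarrow> 'a) \<Rightarrow> int" where
  "fan_cochain l p f = fan_sign (vertex_labels l p f)"

text \<open>Deleting the label of vertex \<open>k\<close> amounts to passing to the
  \<open>k\<close>-th face, so the parity for multisets becomes a coboundary identity.\<close>

lemma even_fan_cochain_coboundary:
  assumes "singular_simplex p X f" "p > 0" "compatible (vertex_labels l p f)"
    and "\<And>x. x \<in> topspace X \<Longrightarrow> l (a x) = opposite (l x)"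
  shows "even ((\<Sum>k\<le>p. (-1) ^ k * fan_cochain l (p - Suc 0) (singular_face p k f))
               + (fan_cochain l p f + fan_cochain l p (simplex_map p a f)))"
proof -
  have "(\<Sum>x\<in>#vertex_labels l p f. fan_sign (vertex_labels l p f - {#x#}))
      = (\<Sum>k\<le>p. fan_cochain l (p - Suc 0) (singular_face p k f))"
    unfolding sum_unfold_sum_mset fan_cochain_def
    by (subst vertex_labels_def, unfold multiset.map_comp, intro arg_cong[of _ _ sum_mset] image_mset_cong)
       (use assms(2) in \<open>auto simp: vertex_labels_singular_face\<close>)
  \<comment> \<open>The signs of the boundary formula are invisible modulo 2.\<close>
  moreover have "even ((\<Sum>k\<le>p. (-1) ^ k * \<psi> k) + (\<Sum>k\<le>p. \<psi> k))" for \<psi> :: "nat \<Rightarrow> int"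
    unfolding sum.distrib[symmetric]
    by (intro dvd_sum) (auto simp: minus_one_power_iff)
  ultimately show ?thesis
    using even_fan_sign_coboundary[OF assms(3)]
      vertex_labels_simplex_map[of p X f l a, OF assms(1) assms(4)]
    by (fastforce simp: fan_cochain_def)
qed

text \<open>At a point exactly one of a label and its opposite is odd. Then the boundary relation
  turns an odd value in dimension \<open>k\<close> into an odd value on the boundary of
  \<open>h (Suc k)\<close>, which Fan's identity carries to dimension \<open>Suc k\<close>.\<close>

lemma odd_fan_cochain:
  assumes "\<And>k. k \<le> d \<Longrightarrow> singular_chain k X (h k)"
    and "h 0 = frag_of \<sigma>"
    and "\<And>k. k < d \<Longrightarrow> chain_boundary (Suc k) (h (Suc k))
                     = h k + frag_cmul ((-1) ^ Suc k) (chain_map k a (h k))"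
    and "\<And>k f. k \<le> d \<Longrightarrow> f \<in> Poly_Mapping.keys (h k) \<Longrightarrow> compatible (vertex_labels l k f)"
    and "\<And>x. x \<in> topspace X \<Longrightarrow> l (a x) = opposite (l x)"
    and "k \<le> d"
  shows "odd (chain_eval (fan_cochain l k) (h k) + chain_eval (fan_cochain l k) (chain_map k a (h k)))"
  using \<open>k \<le> d\<close>
proof (induction k)
  case 0
  have "singular_simplex 0 X \<sigma>" using assms(1)[of 0] assms(2) by (simp add: singular_chain_of)
  then have "vertex_labels l 0 (simplex_map 0 a \<sigma>) = image_mset opposite (vertex_labels l 0 \<sigma>)"
    using assms(5) by (rule vertex_labels_simplex_map)
  then show ?case
    by (simp add: assms(2) fan_cochain_def vertex_labels_def fan_sign_def odd_opposite)
next
  case (Suc k)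
  let ?\<phi> = "fan_cochain l"
  have "chain_eval (?\<phi> (Suc k)) (h (Suc k)) + chain_eval (?\<phi> (Suc k)) (chain_map (Suc k) a (h (Suc k)))
      = chain_eval (\<lambda>f. ?\<phi> (Suc k) f + ?\<phi> (Suc k) (simplex_map (Suc k) a f)) (h (Suc k))"
    by (simp add: chain_eval_chain_map chain_eval_fun_add)
  moreover have "chain_eval (?\<phi> k) (chain_boundary (Suc k) (h (Suc k)))
      = chain_eval (?\<phi> k) (h k) + (-1) ^ Suc k * chain_eval (?\<phi> k) (chain_map k a (h k))"
    using Suc.prems by (simp add: assms(3) chain_eval_add chain_eval_cmul)
  then have "odd (chain_eval (?\<phi> k) (chain_boundary (Suc k) (h (Suc k))))"
    using Suc by (auto simp: minus_one_power_iff)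
  moreover have "even (chain_eval (?\<phi> k) (chain_boundary (Suc k) (h (Suc k)))
      + chain_eval (\<lambda>f. ?\<phi> (Suc k) f + ?\<phi> (Suc k) (simplex_map (Suc k) a f)) (h (Suc k)))"
    unfolding chain_eval_boundary[OF zero_less_Suc] chain_eval_fun_add[symmetric]
  proof (rule even_chain_eval)
    fix f assume f: "f \<in> Poly_Mapping.keys (h (Suc k))"
    then have "singular_simplex (Suc k) X f"
      using assms(1)[OF Suc.prems] by (auto simp: singular_chain_def)
    then show "even ((\<Sum>j\<le>Suc k. (-1) ^ j * ?\<phi> k (singular_face (Suc k) j f))
        + (?\<phi> (Suc k) f + ?\<phi> (Suc k) (simplex_map (Suc k) a f)))"
      using even_fan_cochain_coboundary[of "Suc k" X f l a] assms(4)[OF Suc.prems f] assms(5) by simp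
  qed
  ultimately show ?case by presburger
qed

section \<open>The Borsuk--Ulam theorem\<close>

lemma continuous_map_nsphere_antipode:
  "continuous_map (nsphere n) (nsphere n) (\<lambda>x i. - x i)"
  unfolding nsphere
  by (auto simp: continuous_map_in_subtopology continuous_map_componentwise_UNIV
      intro!: continuous_map_minus continuous_map_from_subtopology continuous_map_product_projection)

text \<open>Reduced homology vanishes below dimension \<open>d\<close>. In dimension 0 the class of
  \<open>c\<close> is reduced only if its augmentation, its image in a one-point space, vanishes;
  this is what \<open>aug\<close> provides.\<close>

lemma nsphere_cycle_bounds:
  assumes "k < d" and c: "singular_relcycle k (nsphere d) {} c"
    and aug: "chain_map k (\<lambda>_. ()) c = 0 \<or> k > 0"
  obtains e where "singular_chain (Suc k) (nsphere d) e" "chain_boundary (Suc k) e = c"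
proof -
  let ?X = "nsphere d" and ?P = "discrete_topology {()}"
  let ?C = "homologous_rel_set k ?X {} c"
  have C: "?C \<in> carrier (homology_group k ?X)"
    using c by (auto simp: carrier_relative_homology_group)
  have "?C \<in> carrier (reduced_homology_group k ?X)"
  proof (cases "k > 0")
    case True
    then show ?thesis using C by (simp add: un_reduced_homology_group)
  next
    case False
    with aug have "chain_map k (\<lambda>_. ()) c = 0" by simp
    then have "hom_induced k ?X {} ?P {} (\<lambda>x. ()) ?C = \<one>\<^bsub>homology_group k ?P\<^esub>"
      using c by (simp add: hom_induced_chain_map homologous_rel_set_eq_relboundary)
    then show ?thesis using C by (simp add: carrier_reduced_homology_group kernel_def)
  qed
  moreover have "trivial_group (reduced_homology_group k ?X)"
    using \<open>k < d\<close> by (simp add: trivial_reduced_homology_group_nsphere)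
  ultimately have "?C = singular_relboundary_set k ?X {}"
    by (auto simp: trivial_group_def one_reduced_homology_group)
  then have "singular_relboundary k ?X {} c"
    by (simp add: homologous_rel_set_eq_relboundary)
  then show thesis using that by (auto simp: singular_boundary)
qed

text \<open>The prescribed boundary is a cycle below dimension \<open>d\<close>, hence it bounds a
  chain, which is taken as the next member.\<close>

lemma antipodal_chains_exist:
  assumes "D \<le> d"
  shows "\<exists>h \<sigma>. (\<forall>k\<le>D. singular_chain k (nsphere d) (h k)) \<and> h 0 = frag_of \<sigma> \<and>
    (\<forall>k<D. chain_boundary (Suc k) (h (Suc k))
           = h k + frag_cmul ((-1) ^ Suc k) (chain_map k (\<lambda>x i. - x i) (h k)))"
  using assms
proof (induction D)
  case 0
  define \<sigma> where "\<sigma> = restrict (\<lambda>_. (\<lambda>n::nat. if n = 0 then 1 else 0 :: real)) (standard_simplex 0)"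
  have "singular_simplex 0 (nsphere d) \<sigma>"
    using in_topspace_nsphere by (simp add: singular_simplex_def \<sigma>_def)
  then show ?case
    by (intro exI[of _ "\<lambda>_. frag_of \<sigma>"] exI[of _ \<sigma>]) (simp add: singular_chain_of)
next
  case (Suc D)
  let ?a = "\<lambda>x i. - x i :: real" and ?X = "nsphere d"
  from Suc obtain h \<sigma> where h: "\<And>k. k \<le> D \<Longrightarrow> singular_chain k ?X (h k)" and h0: "h 0 = frag_of \<sigma>"
    and bd: "\<And>k. k < D \<Longrightarrow> chain_boundary (Suc k) (h (Suc k))
           = h k + frag_cmul ((-1) ^ Suc k) (chain_map k ?a (h k))" by auto
  have aa: "chain_map k ?a (chain_map k ?a c) = c" if "singular_chain k ?X c" for k c
  proof -
    have "chain_map k (?a \<circ> ?a) c = c" by (rule chain_map_id_gen[OF that]) simp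
    then show ?thesis by (simp only: chain_map_compose o_apply)
  qed
  define z where "z = h D + frag_cmul ((-1) ^ Suc D) (chain_map D ?a (h D))"
  have z: "singular_chain D ?X z"
    unfolding z_def using h[of D]
    by (intro singular_chain_add singular_chain_cmul singular_chain_chain_map[OF _ continuous_map_nsphere_antipode]) auto
  moreover have "chain_boundary D z = 0"
  proof (cases D)
    case 0
    then show ?thesis by (simp add: chain_boundary_def)
  next
    case (Suc k)
    have "chain_boundary D z = chain_boundary D (h D)
        + frag_cmul ((-1) ^ Suc D) (chain_map k ?a (chain_boundary D (h D)))"
      using chain_boundary_chain_map[OF h[of D], of ?a] Suc
      by (simp add: z_def chain_boundary_add chain_boundary_cmul)
    \<comment> \<open>With s = (-1)^D and \<open>a\<close> the antipodal map, the product (1 - s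
      a)(1 + s a) = 1 - a^2 is zero.\<close>
    also have "\<dots> = 0"
      using bd[of k] aa[OF h[of k]] Suc
      by (simp add: chain_map_add frag_cmul_distrib2 minus_one_power_iff)
    finally show ?thesis .
  qed
  moreover have "chain_map D (\<lambda>_. ()) z = 0 \<or> D > 0"
  proof (cases "D = 0")
    case True
    \<comment> \<open>Here \<open>z\<close> is a point minus its antipode, and both have the same
      image in the one-point space.\<close>
    have "chain_map 0 (\<lambda>_. ()) (chain_map 0 ?a c) = chain_map 0 (\<lambda>_. ()) c" for c :: "(nat \<Rightarrow> real) chain"
    proof -
      have "chain_map 0 ((\<lambda>_. ()) \<circ> ?a) c = chain_map 0 (\<lambda>_. ()) c"
        by (rule arg_cong[of _ _ "\<lambda>u. chain_map 0 u c"]) (rule ext, simp only: o_apply)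
      then show ?thesis by (simp only: chain_map_compose o_apply)
    qed
    moreover have "z = h 0 - chain_map 0 ?a (h 0)" using True by (simp add: z_def)
    ultimately have "chain_map 0 (\<lambda>_. ()) z = 0" by (simp only: chain_map_diff diff_self)
    then show ?thesis using True by simp
  qed simp
  ultimately obtain e where e: "singular_chain (Suc D) ?X e" "chain_boundary (Suc D) e = z"
    using nsphere_cycle_bounds[of D d z] Suc.prems by (auto simp: singular_cycle)
  show ?case
  proof (intro exI conjI allI impI)
    fix k assume "k \<le> Suc D"
    then show "singular_chain k ?X ((h(Suc D := e)) k)" using h e by (auto simp: le_Suc_eq)
  next
    show "(h(Suc D := e)) 0 = frag_of \<sigma>" using h0 by simp
  next
    fix k assume "k < Suc D"
    then show "chain_boundary (Suc k) ((h(Suc D := e)) (Suc k)) = (h(Suc D := e)) k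
           + frag_cmul ((-1) ^ Suc k) (chain_map k ?a ((h(Suc D := e)) k))"
      using bd e by (auto simp: less_Suc_eq z_def)
  qed
qed

lemma singular_chain_power_subdivision:
  "singular_chain p X c \<Longrightarrow> singular_chain p X ((singular_subdivision p ^^ m) c)"
  by (induction m) (auto intro: singular_chain_singular_subdivision)

text \<open>Subdivision is a natural chain map and is trivial in dimension 0, so simplices can be
  made small without losing the relations.\<close>

lemma antipodal_chains_subdivide:
  assumes h: "\<And>k. k \<le> d \<Longrightarrow> singular_chain k X (h k)" and h0: "h 0 = frag_of \<sigma>"
    and bd: "\<And>k. k < d \<Longrightarrow> chain_boundary (Suc k) (h (Suc k))
           = h k + frag_cmul ((-1) ^ Suc k) (chain_map k a (h k))"
    and "continuous_map X X a"
  defines "h' \<equiv> \<lambda>m k. (singular_subdivision k ^^ m) (h k)"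
  shows "h' m 0 = frag_of \<sigma>"
    and "k < d \<Longrightarrow> chain_boundary (Suc k) (h' m (Suc k))
           = h' m k + frag_cmul ((-1) ^ Suc k) (chain_map k a (h' m k))"
proof -
  have sc: "singular_chain k X (h' m k)" if "k \<le> d" for k m
    using h[OF that] by (simp add: h'_def singular_chain_power_subdivision)
  show "h' m 0 = frag_of \<sigma>"
  proof (induction m)
    case 0
    then show ?case by (simp add: h'_def h0)
  next
    case (Suc m)
    then show ?case using singular_subdivision_zero[OF sc[of 0 m]] by (simp add: h'_def)
  qed
  show "chain_boundary (Suc k) (h' m (Suc k))
           = h' m k + frag_cmul ((-1) ^ Suc k) (chain_map k a (h' m k))" if "k < d"
  proof (induction m)
    case 0
    then show ?case using bd[OF that] by (simp add: h'_def)
  next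
    case (Suc m)
    have "chain_boundary (Suc k) (h' (Suc m) (Suc k))
        = singular_subdivision k (chain_boundary (Suc k) (h' m (Suc k)))"
      using chain_boundary_singular_subdivision[OF sc[of "Suc k" m]] that by (simp add: h'_def)
    also have "\<dots> = singular_subdivision k (h' m k)
        + frag_cmul ((-1) ^ Suc k) (singular_subdivision k (chain_map k a (h' m k)))"
      unfolding Suc singular_subdivision_add
      by (simp add: singular_subdivision_def frag_extend_cmul)
    also have "singular_subdivision k (chain_map k a (h' m k)) = chain_map k a (singular_subdivision k (h' m k))"
      using sc[of k m] that by (intro naturality_singular_subdivision) auto
    finally show ?case by (simp add: h'_def)
  qed
qed

theorem Borsuk_Ulam_nsphere:
  fixes g :: "nat \<Rightarrow> (nat \<Rightarrow> real) \<Rightarrow> real"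
  assumes cont: "\<And>i. i < d \<Longrightarrow> continuous_map (nsphere d) euclideanreal (g i)"
    and odd: "\<And>i x. i < d \<Longrightarrow> x \<in> topspace (nsphere d) \<Longrightarrow> g i (\<lambda>j. - x j) = - g i x"
  obtains x where "x \<in> topspace (nsphere d)" "\<And>i. i < d \<Longrightarrow> g i x = 0"
proof -
  let ?X = "nsphere d" and ?a = "\<lambda>x i. - x i :: real"
  have False if nz: "\<And>x. x \<in> topspace ?X \<Longrightarrow> \<exists>i<d. g i x \<noteq> 0"
  proof -
    \<comment> \<open>Only absolute values enter \<open>top\<close>, so breaking ties by the least
      index gives antipodal points the same index and opposite signs.\<close>
    define top where "top = (\<lambda>x i. i < d \<and> g i x \<noteq> 0 \<and> (\<forall>j<d. \<bar>g j x\<bar> \<le> \<bar>g i x\<bar>))"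
    define idx where "idx = (\<lambda>x. LEAST i. top x i)"
    define l where "l = (\<lambda>x. 2 * idx x + (if g (idx x) x > 0 then 1 else 0))"
    have top: "top x (idx x)" if x: "x \<in> topspace ?X" for x
    proof -
      obtain i where i: "i < d" "g i x \<noteq> 0" using nz[OF x] by auto
      let ?M = "Max ((\<lambda>i. \<bar>g i x\<bar>) ` {..<d})"
      have "?M \<in> (\<lambda>i. \<bar>g i x\<bar>) ` {..<d}" using i by (intro Max_in) auto
      then obtain k where k: "k < d" "?M = \<bar>g k x\<bar>" by auto
      have le: "\<bar>g j x\<bar> \<le> \<bar>g k x\<bar>" if "j < d" for j
        using that unfolding k(2)[symmetric] by (intro Max_ge) auto
      have "top x k" using k le le[OF i(1)] i(2) by (auto simp: top_def)
      then show ?thesis unfolding idx_def by (rule LeastI)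
    qed
    have a_in: "?a x \<in> topspace ?X" if "x \<in> topspace ?X" for x
      using continuous_map_nsphere_antipode that by (auto simp: continuous_map_def)
    have l_odd: "l (?a x) = opposite (l x)" if x: "x \<in> topspace ?X" for x
    proof -
      have "top (?a x) = top x" using odd[OF _ x] by (auto simp: top_def fun_eq_iff)
      then have "idx (?a x) = idx x" by (simp add: idx_def)
      moreover have "g (idx x) (?a x) = - g (idx x) x" "g (idx x) x \<noteq> 0"
        using top[OF x] odd[OF _ x] by (auto simp: top_def)
      ultimately show ?thesis by (auto simp: l_def opposite_def)
    qed
    \<comment> \<open>On \<open>W x\<close> no two labels are opposite: functions nonzero at
      \<open>x\<close> keep their sign, and those vanishing at \<open>x\<close> are dominated by
      that of index \<open>idx x\<close>.\<close>
    define W where "W = (\<lambda>x. {y \<in> topspace ?X.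
        (\<forall>i<d. (g i x > 0 \<longrightarrow> g i y > 0) \<and> (g i x < 0 \<longrightarrow> g i y < 0)
              \<and> (g i x = 0 \<longrightarrow> \<bar>g i y\<bar> < \<bar>g (idx x) y\<bar>))})"
    have W_open: "openin ?X (W x)" if x: "x \<in> topspace ?X" for x
    proof -
      have idx: "idx x < d" using top[OF x] by (simp add: top_def)
      define F where "F = (\<lambda>i y. if g i x > 0 then g i y else if g i x < 0 then - g i y
                                 else \<bar>g (idx x) y\<bar> - \<bar>g i y\<bar>)"
      have F_iff: "F i y > 0 \<longleftrightarrow> (g i x > 0 \<longrightarrow> g i y > 0) \<and> (g i x < 0 \<longrightarrow> g i y < 0)
              \<and> (g i x = 0 \<longrightarrow> \<bar>g i y\<bar> < \<bar>g (idx x) y\<bar>)" for i y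
        by (simp add: F_def)
      have eq: "W x = (\<Inter>i\<in>{..<d}. {y \<in> topspace ?X. F i y \<in> {0<..}})"
        using idx by (auto simp: W_def F_iff)
      have "openin ?X {y \<in> topspace ?X. F i y \<in> {0<..}}" if i: "i < d" for i
      proof (rule openin_continuous_map_preimage)
        show "continuous_map ?X euclideanreal (F i)"
          using cont[OF i] cont[OF idx] unfolding F_def
          by (auto intro!: continuous_map_minus continuous_map_diff continuous_map_real_abs)
        show "openin euclideanreal {0::real<..}" by simp
      qed
      then show ?thesis
        unfolding eq using idx by (intro openin_INT2) auto
    qed
    have W_self: "x \<in> W x" if x: "x \<in> topspace ?X" for x
      using x top[OF x] by (auto simp: W_def top_def)
    have W_compat: "l y = l y'" if "y \<in> W x" "y' \<in> W x" "l y div 2 = l y' div 2" and x: "x \<in> topspace ?X" for x y y'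
    proof -
      have id: "idx y = idx y'" using that(3) by (auto simp: l_def split: if_splits)
      have ty: "top y (idx y)" "top y' (idx y)" using that top[of y] top[of y'] id by (auto simp: W_def)
      have "g (idx y) x \<noteq> 0"
      proof
        assume "g (idx y) x = 0"
        then have "\<bar>g (idx y) y\<bar> < \<bar>g (idx x) y\<bar>" using that(1) ty by (auto simp: W_def top_def)
        moreover have "idx x < d" using top[OF x] by (simp add: top_def)
        ultimately show False using ty(1) by (force simp: top_def)
      qed
      then have "g (idx y) y > 0 \<longleftrightarrow> g (idx y) y' > 0"
        using that(1,2) ty by (auto simp: W_def top_def)
      then show ?thesis using id by (simp add: l_def)
    qed
    obtain h \<sigma> where h: "\<And>k. k \<le> d \<Longrightarrow> singular_chain k ?X (h k)" and h0: "h 0 = frag_of \<sigma>"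
      and bd: "\<And>k. k < d \<Longrightarrow> chain_boundary (Suc k) (h (Suc k))
           = h k + frag_cmul ((-1) ^ Suc k) (chain_map k ?a (h k))"
      using antipodal_chains_exist[of d d] by auto
    \<comment> \<open>Iterated subdivision makes the simplices subordinate to the open cover by the
      sets \<open>W x\<close>.\<close>
    have "\<exists>n. \<forall>m\<ge>n. \<forall>f\<in>Poly_Mapping.keys ((singular_subdivision k ^^ m) (h k)).
            \<exists>V\<in>W ` topspace ?X. f \<in> standard_simplex k \<rightarrow> V" if "k \<le> d" for k
      by (rule sufficient_iterated_singular_subdivision_exists[of "W ` topspace ?X" ?X k "h k"])
         (use that W_open W_self h in blast)+
    then obtain N where N: "\<And>k m f. k \<le> d \<Longrightarrow> m \<ge> N k \<Longrightarrow>
        f \<in> Poly_Mapping.keys ((singular_subdivision k ^^ m) (h k)) \<Longrightarrow>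
        \<exists>V\<in>W ` topspace ?X. f \<in> standard_simplex k \<rightarrow> V"
      by metis
    \<comment> \<open>All dimensions are subdivided equally often, so that the boundary relations
      still link the chains.\<close>
    define m where "m = Max (N ` {..d})"
    define h' where "h' = (\<lambda>k. (singular_subdivision k ^^ m) (h k))"
    have compat: "compatible (vertex_labels l k f)" if k: "k \<le> d" and f: "f \<in> Poly_Mapping.keys (h' k)" for k f
    proof -
      have "N k \<le> m" using k by (auto simp: m_def)
      then obtain x where x: "x \<in> topspace ?X" "f \<in> standard_simplex k \<rightarrow> W x"
        using N[OF k, of m f] f unfolding h'_def by blast
      show ?thesis unfolding compatible_def
        using W_compat[OF _ _ _ x(1)] x(2) by (blast elim!: in_vertex_labelsE)
    qed
    have sc': "singular_chain k ?X (h' k)" if "k \<le> d" for k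
      using h[OF that] by (simp add: h'_def singular_chain_power_subdivision)
    have "odd (chain_eval (fan_cochain l d) (h' d) + chain_eval (fan_cochain l d) (chain_map d ?a (h' d)))"
    proof (rule odd_fan_cochain[where h = h' and X = ?X and d = d])
      show "h' 0 = frag_of \<sigma>"
        using antipodal_chains_subdivide(1)[OF h h0 bd continuous_map_nsphere_antipode, of d m]
        by (simp add: h'_def)
      show "chain_boundary (Suc k) (h' (Suc k)) = h' k + frag_cmul ((-1) ^ Suc k) (chain_map k ?a (h' k))"
        if "k < d" for k
        using antipodal_chains_subdivide(2)[OF h h0 bd continuous_map_nsphere_antipode that, of m]
        by (simp add: h'_def)
    qed (use sc' compat l_odd in auto)
    moreover have "fan_cochain l d f = 0 \<and> fan_cochain l d (simplex_map d ?a f) = 0"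
      if f: "f \<in> Poly_Mapping.keys (h' d)" for f
    proof -
      have sf: "singular_simplex d ?X f" using sc'[of d] f by (auto simp: singular_chain_def)
      then have in_X: "f v \<in> topspace ?X" if "v \<in> standard_simplex d" for v
        using that by (auto simp: singular_simplex_def continuous_map_def)
      have c: "compatible (vertex_labels l d f)" using compat f by simp
      have lt: "l x < 2 * d" if "x \<in> topspace ?X" for x
        using top[OF that] by (auto simp: top_def l_def)
      have "x < 2 * d" if "x \<in># vertex_labels l d f" for x
        using that in_X lt by (auto elim!: in_vertex_labelsE)
      moreover have "x < 2 * d" if "x \<in># image_mset opposite (vertex_labels l d f)" for x
      proof -
        from that obtain v where "v \<in> standard_simplex d" "x = opposite (l (f v))"
          by (auto elim!: in_vertex_labelsE)
        then show ?thesis using l_odd[OF in_X] lt[OF a_in[OF in_X]] by metis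
      qed
      moreover have "compatible (image_mset opposite (vertex_labels l d f))"
      proof -
        have "opposite x div 2 = x div 2" for x by (auto simp: opposite_def elim!: oddE)
        then show ?thesis using c by (auto simp: compatible_def)
      qed
      moreover have "vertex_labels l d (simplex_map d ?a f) = image_mset opposite (vertex_labels l d f)"
        by (rule vertex_labels_simplex_map[OF sf]) (rule l_odd)
      ultimately show ?thesis
        unfolding fan_cochain_def using fan_sign_eq_0[of _ d] c size_vertex_labels[of l d f]
        by (metis lessI size_image_mset)
    qed
    then have "even (chain_eval (fan_cochain l d) (h' d))"
      "even (chain_eval (fan_cochain l d) (chain_map d ?a (h' d)))"
      unfolding chain_eval_chain_map by (auto intro!: even_chain_eval)
    ultimately show False by simp
  qed
  then show thesis using that by blast
qed

section \<open>Transfer to the unit sphere of a Euclidean space\<close>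

lemma basis_enumeration:
  assumes "DIM('a::euclidean_space) = d + 1"
  obtains e :: "nat \<Rightarrow> 'a::euclidean_space" where "bij_betw e {..d} Basis"
proof -
  have "card {..d} = card (Basis :: 'a set)" using assms by simp
  then show thesis using that finite_same_card_bij[of "{..d}" "Basis :: 'a set"] by auto
qed

theorem Borsuk_Ulam_sphere:
  fixes g :: "nat \<Rightarrow> 'a::euclidean_space \<Rightarrow> real"
  assumes dim: "DIM('a) = d + 1"
    and cont: "\<And>i. i < d \<Longrightarrow> continuous_on (sphere 0 1) (g i)"
    and odd: "\<And>i x. i < d \<Longrightarrow> x \<in> sphere 0 1 \<Longrightarrow> g i (- x) = - g i x"
  obtains x where "x \<in> sphere 0 1" "\<And>i. i < d \<Longrightarrow> g i x = 0"
proof -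
  obtain e :: "nat \<Rightarrow> 'a" where e: "bij_betw e {..d} Basis"
    using basis_enumeration[OF dim] by blast
  \<comment> \<open>Coordinates become coefficients in an orthonormal basis, which preserves the
    norm and commutes with negation.\<close>
  define F where "F = (\<lambda>x. \<Sum>i\<le>d. x i *\<^sub>R e i)"
  have in_Basis: "e i \<in> Basis" if "i \<le> d" for i using e that by (auto simp: bij_betw_def)
  have inner_e: "e i \<bullet> e j = (if i = j then 1 else 0)" if "i \<le> d" "j \<le> d" for i j
    using in_Basis[OF that(1)] in_Basis[OF that(2)] e that
    by (auto simp: inner_Basis bij_betw_def inj_on_def)
  have "F x \<bullet> F x = (\<Sum>i\<le>d. (x i)\<^sup>2)" for x
  proof -
    have "F x \<bullet> F x = (\<Sum>i\<le>d. \<Sum>j\<le>d. x i * (x j * (e i \<bullet> e j)))"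
      by (simp add: F_def inner_sum_left inner_sum_right sum_distrib_left)
         (subst sum.swap, simp add: inner_commute mult.left_commute)
    also have "\<dots> = (\<Sum>i\<le>d. \<Sum>j\<le>d. if i = j then (x i)\<^sup>2 else 0)"
      by (intro sum.cong refl) (auto simp: inner_e power2_eq_square)
    finally show ?thesis by simp
  qed
  then have F_in: "F x \<in> sphere 0 1" if "x \<in> topspace (nsphere d)" for x
    using that by (simp add: nsphere norm_eq_sqrt_inner)
  have "continuous_map (nsphere d) euclidean F"
    unfolding F_def
  proof (intro continuous_map_sum)
    show "continuous_map (nsphere d) euclidean (\<lambda>x. x i *\<^sub>R e i)" for i
      using continuous_map_compose[OF continuous_map_nsphere_projection, of euclidean "\<lambda>r. r *\<^sub>R e i" d i]
      by (simp add: o_def continuous_map_iff_continuous2 continuous_intros)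
  qed simp
  then have F_cont: "continuous_map (nsphere d) (top_of_set (sphere 0 1)) F"
    using F_in by (auto simp: continuous_map_in_subtopology)
  obtain x where x: "x \<in> topspace (nsphere d)" "\<And>i. i < d \<Longrightarrow> (g i \<circ> F) x = 0"
  proof (rule Borsuk_Ulam_nsphere[of d "\<lambda>i. g i \<circ> F"])
    show "continuous_map (nsphere d) euclideanreal (g i \<circ> F)" if "i < d" for i
      using cont[OF that] by (intro continuous_map_compose[OF F_cont]) simp
    show "(g i \<circ> F) (\<lambda>j. - x j) = - (g i \<circ> F) x" if "i < d" "x \<in> topspace (nsphere d)" for i x
    proof -
      have "F (\<lambda>j. - x j) = - F x" by (simp add: F_def sum_negf)
      then show ?thesis using odd[OF that(1) F_in[OF that(2)]] by simp
    qed
  qed auto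
  then show thesis using that[OF F_in] by simp
qed

section \<open>The lower bound\<close>

text \<open>The witness is the difference of the distances of \<open>x\<close> and
  \<open>- x\<close> to the complement of \<open>V\<close> in the sphere; at most one of them is
  positive.\<close>

lemma antipodal_set_detector:
  fixes V :: "'a::euclidean_space set"
  assumes V: "V \<subseteq> sphere 0 1" "openin (top_of_set (sphere 0 1)) V" "\<forall>x\<in>V. - x \<notin> V"
  obtains v :: "'a \<Rightarrow> real" where "continuous_on UNIV v" "\<And>x. v (- x) = - v x"
    "\<And>x. x \<in> sphere 0 1 \<Longrightarrow> v x > 0 \<longleftrightarrow> x \<in> V"
proof -
  let ?S = "sphere 0 1 :: 'a set"
  define a where "a = (\<lambda>x. infdist x (?S - V))"
  \<comment> \<open>The complement has to be nonempty, as \<open>infdist\<close> to the empty set is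
    0.\<close>
  obtain b :: 'a where "b \<in> Basis" using nonempty_Basis by blast
  then have "b \<in> ?S" "- b \<in> ?S" by auto
  then have ne: "?S - V \<noteq> {}" using V(3) by blast
  have "closed (?S - V)"
    using V(2) by (metis closed_sphere closedin_closed_trans closedin_diff closedin_self)
  then have a_pos: "a x > 0 \<longleftrightarrow> x \<in> V" if "x \<in> ?S" for x
    using ne that in_closed_iff_infdist_zero[of "?S - V" x] infdist_nonneg[of x "?S - V"]
    unfolding a_def by (metis DiffE DiffI less_eq_real_def less_irrefl)
  have a_nonneg: "a x \<ge> 0" for x by (simp add: a_def infdist_nonneg)
  show thesis
  proof (rule that[of "\<lambda>x. a x - a (- x)"])
    show "continuous_on UNIV (\<lambda>x. a x - a (- x))"
      unfolding a_def by (intro continuous_intros)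
    show "a x - a (- x) > 0 \<longleftrightarrow> x \<in> V" if "x \<in> ?S" for x
    proof -
      have "- x \<in> ?S" using that by simp
      then show ?thesis using a_pos[OF that] a_pos[of "- x"] a_nonneg[of x] a_nonneg[of "- x"] V(3)
        by force
    qed
  qed simp
qed

theorem antipodal_cover_lower_bound:
  fixes U :: "nat \<Rightarrow> 'a::euclidean_space set"
  assumes dim: "DIM('a) = d + 1" and "n \<ge> 1" and cover: "antipodal_open_nfold_cover n U m"
  shows "\<exists>x\<in>sphere 0 1. n + (d + 1) div 2 \<le> covered_count U m x"
proof (rule ccontr)
  let ?S = "sphere 0 1 :: 'a set"
  assume "\<not> ?thesis"
  then have upper: "covered_count U m x < n + (d + 1) div 2" if "x \<in> ?S" for x
    using that by (auto simp: not_le)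
  have lower: "n \<le> covered_count U m x" if "x \<in> ?S" for x
    using cover that by (auto simp: antipodal_open_nfold_cover_def)
  have "\<exists>v :: 'a \<Rightarrow> real. continuous_on UNIV v \<and> (\<forall>x. v (- x) = - v x) \<and> (\<forall>x\<in>?S. v x > 0 \<longleftrightarrow> x \<in> U i)"
    if "i < m" for i
    using antipodal_set_detector[of "U i"] cover that unfolding antipodal_open_nfold_cover_def by metis
  then obtain v :: "nat \<Rightarrow> 'a \<Rightarrow> real" where v: "\<And>i. i < m \<Longrightarrow> continuous_on UNIV (v i)"
    "\<And>i x. i < m \<Longrightarrow> v i (- x) = - v i x" "\<And>i x. i < m \<Longrightarrow> x \<in> ?S \<Longrightarrow> v i x > 0 \<longleftrightarrow> x \<in> U i"
    by metis
  \<comment> \<open>At a point of the sphere this is nonzero only if all sets indexed by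
    \<open>A\<close> contain \<open>x\<close> and all those indexed by \<open>B\<close> contain
    \<open>- x\<close>.\<close>
  define w where "w = (\<lambda>A B x. (\<Prod>i\<in>A. max 0 (v i x)) * (\<Prod>i\<in>B. max 0 (- v i x)))"
  \<comment> \<open>Antisymmetric on disjoint nonempty finite sets, whose minima differ;
    \<open>n \<ge> 1\<close> makes the sets nonempty.\<close>
  define sg where "sg = (\<lambda>A B :: nat set. if Min A < Min B then 1 else - 1 :: real)"
  define P where "P = (\<lambda>r. {(A, B). A \<subseteq> {..<m} \<and> B \<subseteq> {..<m} \<and> A \<inter> B = {} \<and>
                       n \<le> card A \<and> n \<le> card B \<and> card A + card B = 2 * n + r})"
  define g where "g = (\<lambda>r x. \<Sum>(A, B)\<in>P r. sg A B * w A B x)"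
  have finP: "finite (P r)" for r
    by (rule finite_subset[of _ "Pow {..<m} \<times> Pow {..<m}"]) (auto simp: P_def)
  have sg_swap: "sg B A = - sg A B" if "(A, B) \<in> P r" for A B r
  proof -
    have "A \<noteq> {}" "B \<noteq> {}" "finite A" "finite B"
      using that \<open>n \<ge> 1\<close> by (auto simp: P_def intro: finite_subset)
    moreover have "A \<inter> B = {}" using that by (auto simp: P_def)
    ultimately have "Min A \<noteq> Min B" by (metis Min_in disjoint_iff)
    then show ?thesis by (auto simp: sg_def)
  qed
  have w_neg: "w A B (- x) = w B A x" if "(A, B) \<in> P r" for A B r x
  proof -
    have "v i (- x) = - v i x" if "i \<in> A \<union> B" for i
      using that \<open>(A, B) \<in> P r\<close> by (intro v(2)) (auto simp: P_def)
    then show ?thesis by (simp add: w_def mult.commute)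
  qed
  obtain x where x: "x \<in> ?S" "\<And>r. r < d \<Longrightarrow> g r x = 0"
  proof (rule Borsuk_Ulam_sphere[OF dim, of g])
    show "continuous_on ?S (g r)" for r
      unfolding g_def w_def case_prod_beta
      by (intro continuous_intros continuous_on_subset[OF v(1)]) (auto simp: P_def)
    \<comment> \<open>Negating \<open>x\<close> swaps the two sets in the weight, while swapping
      them flips the sign.\<close>
    show "g r (- x) = - g r x" for r x
    proof -
      have "g r (- x) = (\<Sum>(A, B)\<in>P r. sg A B * w B A x)"
        unfolding g_def by (intro sum.cong) (auto simp: w_neg)
      also have "\<dots> = (\<Sum>(A, B)\<in>P r. sg B A * w A B x)"
        by (rule sum.reindex_bij_witness[of _ prod.swap prod.swap]) (auto simp: P_def)
      also have "\<dots> = (\<Sum>(A, B)\<in>P r. - (sg A B * w A B x))"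
        by (intro sum.cong) (auto simp: sg_swap)
      finally show ?thesis by (simp add: g_def case_prod_beta sum_negf)
    qed
  qed auto
  define A where "A = {i. i < m \<and> x \<in> U i}"
  define B where "B = {i. i < m \<and> - x \<in> U i}"
  have mx: "- x \<in> ?S" using x(1) by simp
  have A_pos: "v i x > 0 \<longleftrightarrow> i \<in> A" if "i < m" for i
    using v(3)[OF that x(1)] that by (simp add: A_def)
  have B_neg: "- v i x > 0 \<longleftrightarrow> i \<in> B" if "i < m" for i
    using v(3)[OF that mx] v(2)[OF that] that by (simp add: B_def)
  have sub: "A \<subseteq> {..<m}" "B \<subseteq> {..<m}" by (auto simp: A_def B_def)
  then have fin: "finite A" "finite B" by (auto intro: finite_subset)
  have cards: "n \<le> card A" "n \<le> card B" "card A < n + (d + 1) div 2" "card B < n + (d + 1) div 2"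
    using lower[OF x(1)] lower[OF mx] upper[OF x(1)] upper[OF mx]
    by (auto simp: A_def B_def covered_count_def)
  define r where "r = card A + card B - 2 * n"
  \<comment> \<open>Each cardinality is at most \<open>n + (d + 1) div 2 - 1\<close>, so
    \<open>r\<close> is at most \<open>d - 1\<close>.\<close>
  have "r < d" using cards by (simp add: r_def)
  have AB: "(A, B) \<in> P r"
  proof -
    have False if "i \<in> A" "i \<in> B" for i
    proof -
      have "i < m" using that(1) sub(1) by auto
      then show False using A_pos[of i] B_neg[of i] that by linarith
    qed
    then have "A \<inter> B = {}" by blast
    then show ?thesis using cards sub by (simp add: P_def r_def)
  qed
  \<comment> \<open>A nonzero weight forces \<open>A' \<subseteq> A\<close> and
    \<open>B' \<subseteq> B\<close>; equal total size then forces equality.\<close>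
  have w_other: "w A' B' x = 0" if "(A', B') \<in> P r - {(A, B)}" for A' B'
  proof (rule ccontr)
    assume nz: "w A' B' x \<noteq> 0"
    have sub': "A' \<subseteq> {..<m}" "B' \<subseteq> {..<m}" using that by (auto simp: P_def)
    then have fin': "finite A'" "finite B'" by (auto intro: finite_subset)
    have "A' \<subseteq> A"
    proof
      fix i assume "i \<in> A'"
      then have "i < m" "max 0 (v i x) \<noteq> 0" using nz sub' fin' by (auto simp: w_def)
      then show "i \<in> A" using A_pos[of i] by (simp add: max_def split: if_splits)
    qed
    moreover have "B' \<subseteq> B"
    proof
      fix i assume "i \<in> B'"
      then have "i < m" "max 0 (- v i x) \<noteq> 0" using nz sub' fin' by (auto simp: w_def)
      then show "i \<in> B" using B_neg[of i] by (simp add: max_def split: if_splits)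
    qed
    moreover have "card A' + card B' = card A + card B" using that AB by (auto simp: P_def)
    ultimately have "A' = A" "B' = B"
      using card_mono[OF fin(1), of A'] card_mono[OF fin(2), of B']
        card_subset_eq[OF fin(1), of A'] card_subset_eq[OF fin(2), of B'] by auto
    then show False using that by simp
  qed
  have "(\<Sum>(A', B')\<in>P r - {(A, B)}. sg A' B' * w A' B' x) = 0"
    by (rule sum.neutral) (use w_other in fastforce)
  then have "g r x = sg A B * w A B x"
    unfolding g_def using sum.remove[OF finP AB, of "\<lambda>(A, B). sg A B * w A B x"] by simp
  moreover have "w A B x > 0"
    unfolding w_def using A_pos B_neg sub by (intro mult_pos_pos prod_pos) (auto simp: less_max_iff_disj subset_iff)
  ultimately have "g r x \<noteq> 0" by (auto simp: sg_def)
  then show False using x(2)[OF \<open>r < d\<close>] by simp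
qed

section \<open>Gale's lemma and the upper bound\<close>

text \<open>With \<open>s = 1\<close> this counts the alternately signed moment-curve vectors at the
  points of the list that lie in the open hemisphere given by the coefficients of
  \<open>p\<close>.\<close>

fun alternating_count :: "real \<Rightarrow> real poly \<Rightarrow> real list \<Rightarrow> nat" where
  "alternating_count s p [] = 0"
| "alternating_count s p (t # ts) = of_bool (s * poly p t > 0) + alternating_count (- s) p ts"

lemma alternating_count_append:
  "alternating_count s p (us @ vs)
   = alternating_count s p us + alternating_count (s * (-1) ^ length us) p vs"
  by (induction us arbitrary: s) auto

lemma alternating_count_cong:
  assumes "\<And>t. t \<in> set ts \<Longrightarrow> s * poly p t > 0 \<longleftrightarrow> s' * poly q t > 0"
    and "\<And>t. t \<in> set ts \<Longrightarrow> - s * poly p t > 0 \<longleftrightarrow> - s' * poly q t > 0"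
  shows "alternating_count s p ts = alternating_count s' q ts"
  using assms by (induction ts arbitrary: s s') auto

text \<open>The wanted sign alternates, so one of any two consecutive points is counted.\<close>

lemma alternating_count_constant_sign:
  assumes "s \<noteq> 0" "(\<forall>t\<in>set ts. poly p t > 0) \<or> (\<forall>t\<in>set ts. poly p t < 0)"
  shows "length ts div 2 \<le> alternating_count s p ts"
  using assms(2)
proof (induction ts rule: induct_list012)
  case (3 t t' ts)
  have "s * poly p t > 0 \<or> - s * poly p t' > 0"
    using "3.prems" assms(1) by (auto simp: zero_less_mult_iff mult_less_0_iff)
  moreover have "length ts div 2 \<le> alternating_count s p ts" using 3 by auto
  ultimately show ?case by auto
qed auto

text \<open>Splitting off a root \<open>a\<close> of \<open>p\<close> together with the first point \<open>t \<ge> a\<close> keeps the signs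
  alternating: the factor \<open>x - a\<close> changes sign exactly where the parity of the positions shifts.\<close>

lemma alternating_count_ge:
  assumes "p \<noteq> 0" "sorted_wrt (<) ts" "2 * n + degree p \<le> length ts" "s \<noteq> 0"
  shows "n \<le> alternating_count s p ts"
  using assms
proof (induction "degree p" arbitrary: p s ts rule: less_induct)
  case less
  show ?case
  \<comment> \<open>A root within the span of the points is split off; without one, the intermediate
    value theorem fixes the sign of \<open>p\<close> on all points.\<close>
  proof (cases "\<exists>a. poly p a = 0 \<and> (\<exists>t\<in>set ts. t \<le> a) \<and> (\<exists>t\<in>set ts. a \<le> t)")
    case True
    then obtain a t0 where a: "poly p a = 0" and "t0 \<in> set ts" "a \<le> t0" by auto
    then obtain us t vs where ts: "ts = us @ t # vs" and t: "a \<le> t" and us: "\<And>u. u \<in> set us \<Longrightarrow> u < a"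
      using split_list_first_prop[of ts "\<lambda>t. a \<le> t"] by (meson not_le)
    have vs: "a < v" if "v \<in> set vs" for v
      using less.prems(2) that t by (auto simp: ts sorted_wrt_append)
    from a obtain q where q: "p = [:- a, 1:] * q" by (auto simp: poly_eq_0_iff_dvd)
    have "q \<noteq> 0" using less.prems(1) q by auto
    then have deg: "degree p = Suc (degree q)" unfolding q by (subst degree_mult_eq) auto
    have "sorted_wrt (<) (us @ vs)" using less.prems(2) by (auto simp: ts sorted_wrt_append)
    \<comment> \<open>One point and one degree are lost together, which preserves the length
      bound.\<close>
    then have "n \<le> alternating_count (- s) q (us @ vs)"
      using less.hyps[of q "us @ vs" "- s"] deg \<open>q \<noteq> 0\<close> less.prems(3,4) by (auto simp: ts)
    also have "\<dots> = alternating_count (- s) q us + alternating_count (- s * (-1) ^ length us) q vs"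
      by (rule alternating_count_append)
    also have "alternating_count (- s) q us = alternating_count s p us"
    proof (rule alternating_count_cong)
      fix u assume "u \<in> set us"
      then have "u < a" by (rule us)
      moreover have "- s' * poly p u = (a - u) * (s' * poly q u)" for s'
        by (simp add: q algebra_simps)
      ultimately have *: "s' * poly q u > 0 \<longleftrightarrow> - s' * poly p u > 0" for s'
        by (simp only: zero_less_mult_iff[of "a - u"]) auto
      show "- s * poly q u > 0 \<longleftrightarrow> s * poly p u > 0" "- (- s) * poly q u > 0 \<longleftrightarrow> - s * poly p u > 0"
        using *[of "- s"] *[of s] by simp_all
    qed
    also have "alternating_count (- s * (-1) ^ length us) q vs = alternating_count (- s * (-1) ^ length us) p vs"
    proof (rule alternating_count_cong)
      fix u assume "u \<in> set vs"
      then have "a < u" by (rule vs)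
      moreover have "s' * poly p u = (u - a) * (s' * poly q u)" for s'
        by (simp add: q algebra_simps)
      ultimately have *: "s' * poly q u > 0 \<longleftrightarrow> s' * poly p u > 0" for s'
        by (simp only: zero_less_mult_iff[of "u - a"]) auto
      show "- s * (-1) ^ length us * poly q u > 0 \<longleftrightarrow> - s * (-1) ^ length us * poly p u > 0"
        "- (- s * (-1) ^ length us) * poly q u > 0 \<longleftrightarrow> - (- s * (-1) ^ length us) * poly p u > 0"
        by (rule *)+
    qed
    also have "alternating_count s p us + alternating_count (- s * (-1) ^ length us) p vs
        \<le> alternating_count s p ts"
      by (simp add: ts alternating_count_append)
    finally show ?thesis by simp
  next
    case False
    have "(\<forall>t\<in>set ts. poly p t > 0) \<or> (\<forall>t\<in>set ts. poly p t < 0)"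
    proof (rule ccontr)
      assume "\<not> ?thesis"
      then obtain t t' where t: "t \<in> set ts" "poly p t \<le> 0" and t': "t' \<in> set ts" "poly p t' \<ge> 0"
        by (auto simp: not_less)
      have "poly p t < 0" "poly p t' > 0"
        using False t t' by (metis antisym_conv1 order_refl)+
      then consider a where "t < a" "a < t'" "poly p a = 0" | a where "t' < a" "a < t" "poly p a = 0"
        using poly_IVT_pos[of t t' p] poly_IVT_neg[of t' t p] by (cases t t' rule: linorder_cases) auto
      then show False using False t(1) t'(1) by cases (metis less_imp_le)+
    qed
    then have "length ts div 2 \<le> alternating_count s p ts"
      using alternating_count_constant_sign less.prems(4) by blast
    then show ?thesis using less.prems(3) by linarith
  qed
qed

lemma alternating_count_upt:
  "alternating_count s p (map real [0..<N]) = card {i. i < N \<and> s * (-1) ^ i * poly p (real i) > 0}"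
proof (induction N)
  case (Suc N)
  have "{i. i < Suc N \<and> s * (-1) ^ i * poly p (real i) > 0}
      = {i. i < N \<and> s * (-1) ^ i * poly p (real i) > 0}
        \<union> (if s * (-1) ^ N * poly p (real N) > 0 then {N} else {})"
    by (auto simp: less_Suc_eq)
  then show ?case using Suc by (simp add: alternating_count_append)
qed simp

theorem antipodal_cover_upper_bound:
  assumes dim: "DIM('a::euclidean_space) = d + 1"
  shows "\<exists>(U :: nat \<Rightarrow> 'a set) m. antipodal_open_nfold_cover n U m \<and>
           (\<forall>x\<in>sphere 0 1. covered_count U m x \<le> d + n)"
proof -
  obtain e :: "nat \<Rightarrow> 'a" where e: "bij_betw e {..d} Basis"
    using basis_enumeration[OF dim] by blast
  \<comment> \<open>Evaluating \<open>p x\<close> at t gives the inner product of \<open>x\<close>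
    with the moment-curve vector (1, t, ..., t^d).\<close>
  define p where "p = (\<lambda>x. \<Sum>k\<le>d. Polynomial.monom (x \<bullet> e k) k)"
  define N where "N = 2 * n + d"
  define U where "U = (\<lambda>i. {x \<in> sphere 0 1. (-1) ^ i * poly (p x) (real i) > 0})"
  have p_minus: "poly (p (- x)) t = - poly (p x) t" for x t
    by (simp add: p_def poly_sum poly_monom sum_negf)
  have lower: "n \<le> covered_count U N x" if x: "x \<in> sphere 0 1" for x
  proof -
    have coeff: "Polynomial.coeff (p x) k = x \<bullet> e k" if "k \<le> d" for k
      using that by (simp add: p_def coeff_sum)
    have "p x \<noteq> 0"
    proof
      assume "p x = 0"
      then have "x \<bullet> b = 0" if "b \<in> Basis" for b
        using that coeff e by (force simp: bij_betw_def)
      then have "x = 0" using euclidean_all_zero_iff by blast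
      then show False using x by simp
    qed
    moreover have "degree (p x) \<le> d"
      unfolding p_def by (intro degree_sum_le) (auto intro: order_trans[OF degree_monom_le])
    ultimately have "n \<le> alternating_count 1 (p x) (map real [0..<N])"
      by (intro alternating_count_ge) (auto simp: N_def sorted_wrt_map)
    then show ?thesis
      using x by (simp add: alternating_count_upt covered_count_def U_def)
  qed
  have upper: "covered_count U N x \<le> d + n" if x: "x \<in> sphere 0 1" for x
  proof -
    have mx: "- x \<in> sphere 0 1" using x by simp
    \<comment> \<open>No set contains both points, so the two counts add up to at most
      \<open>2 * n + d\<close>, and the one at \<open>- x\<close> is at least
      \<open>n\<close>.\<close>
    have "covered_count U N x + covered_count U N (- x)
        = card ({i. i < N \<and> x \<in> U i} \<union> {i. i < N \<and> - x \<in> U i})"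
      unfolding covered_count_def by (subst card_Un_disjoint) (auto simp: U_def p_minus)
    also have "\<dots> \<le> card {..<N}" by (intro card_mono) auto
    finally show ?thesis using lower[OF mx] by (simp add: N_def)
  qed
  have "openin (top_of_set (sphere 0 1)) (U i)" for i
  proof -
    have "open {x :: 'a. (-1) ^ i * poly (p x) (real i) > 0}"
      unfolding p_def poly_sum poly_monom by (intro open_Collect_less continuous_intros)
    moreover have "U i = sphere 0 1 \<inter> {x. (-1) ^ i * poly (p x) (real i) > 0}" by (auto simp: U_def)
    ultimately show ?thesis by (metis openin_open_Int)
  qed
  then have "antipodal_open_nfold_cover n U N"
    using lower by (auto simp: antipodal_open_nfold_cover_def U_def p_minus)
  then show ?thesis using upper by blast
qed

theorem theorem2:
  fixes d n :: nat
  assumes "DIM('a::euclidean_space) = d + 1" and "d \<ge> 1" and "n \<ge> 1"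
  shows "ceiling (real d / 2) + int n \<le> int (Q TYPE('a) n) \<and> Q TYPE('a) n \<le> d + n"
proof -
  define P where "P = (\<lambda>q. \<forall>(U :: nat \<Rightarrow> 'a set) m. antipodal_open_nfold_cover n U m \<longrightarrow>
              (\<exists>x\<in>sphere (0::'a) 1. q \<le> covered_count U m x))"
  have Q: "Q TYPE('a) n = Greatest P" by (simp add: Q_def P_def)
  have low: "P (n + (d + 1) div 2)"
    using antipodal_cover_lower_bound[OF assms(1,3)] by (simp add: P_def)
  \<comment> \<open>Besides giving the upper estimate, boundedness ensures that the greatest element
    exists.\<close>
  have bound: "q \<le> d + n" if "P q" for q
    using antipodal_cover_upper_bound[OF assms(1), of n] that unfolding P_def by (meson le_trans)
  have "n + (d + 1) div 2 \<le> Greatest P" using low bound by (rule Greatest_le_nat)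
  moreover have "Greatest P \<le> d + n" using GreatestI_nat[of P, OF low] bound by blast
  moreover have "ceiling (real d / 2) = int ((d + 1) div 2)"
  proof (cases "even d")
    case True
    then show ?thesis by (auto elim!: evenE)
  next
    case False
    then show ?thesis by (auto elim!: oddE simp: ceiling_eq_iff field_simps)
  qed
  ultimately show ?thesis by (simp add: Q)
qed

end
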